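(* Let $m,n,k,l$ be non-negative integers with $k,l\le\min\{m-2,n-2\}$. Let $X=\{(i,j) : 1\le i\le m,\ 1\le j\le n\}$, and let $Y$ be the two-sided diagonal sub-ladder of $X$ determined by the diagonal paths $C_k$ and $\tilde C_l$. Let $P=(1,n)$ and $Q=(m,1)$. Then the number $w(P,Q)$ of paths in $Y$ from $P$ to $Q$ is $$w(P,Q)=\sum_{(i,j)\in T}(-1)^{i+j}\binom{m+n-2}{m-1+i(k-m)+j(l-n)},$$ where $T=\{(i,j)\in\mathbb{Z}\times\mathbb{Z} : i-j=0\text{ or }1\}$.
   Context: Partial order on $X$: $(i,j)\le(i',j')$ iff $i\ge i'$ and $j\le j'$. A path from $P$ to $Q$ (with $P\ge Q$) is a maximal chain in $X$ with endpoints $P$ and $Q$ (unit steps, each increasing the first coordinate by $1$ or decreasing the second by $1$); a path in $Y$ is one contained in $Y$. $C_k=\{(m-k+i,n-i) : 0\le i\le k\}\cup\{(m-k+i,n-1-i) : 0\le i\le k-1\}$ and $\tilde C_l=\{(i,l+2-i) : 1\le i\le l+1\}\cup\{(i+1,l+2-i) : 1\le i\le l\}$. The two-sided diagonal sub-ladder $Y$ determined by $C_k$ and $\tilde C_l$ is the part of $X$ bounded by $x=1$, $x=m$, $y=1$, $y=n$, $C_k$ and $\tilde C_l$, boundary included; equivalently $Y=\{(i,j)\in X : l+2\le i+j\le m+n-k\}$. Convention: $\binom{N}{p}=0$ if $p<0$ or $p>N$ (so only finitely many terms of the sum are nonzero). *)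

theory Defs
  imports "HOL-Analysis.Analysis"
begin

type_synonym point = "int \<times> int"

definition pt_le :: "point \<Rightarrow> point \<Rightarrow> bool" (infix "\<preceq>" 50) where
  "p \<preceq> q \<longleftrightarrow> fst p \<ge> fst q \<and> snd p \<le> snd q"

definition grid :: "nat \<Rightarrow> nat \<Rightarrow> point set" where
  "grid m n = {(i, j). 1 \<le> i \<and> i \<le> int m \<and> 1 \<le> j \<and> j \<le> int n}"

text \<open>A path from \<open>P\<close> to \<open>Q\<close> is inclusion-maximal among the chains of \<open>X\<close> with greatest element
  \<open>P\<close> and least element \<open>Q\<close>, i.e. it is a maximal chain of the interval from \<open>Q\<close> to \<open>P\<close>.\<close>

definition ladder_path :: "point set \<Rightarrow> point \<Rightarrow> point \<Rightarrow> point set \<Rightarrow> bool" where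
  "ladder_path X P Q C \<longleftrightarrow>
     pred_on.maxchain {R \<in> X. Q \<preceq> R \<and> R \<preceq> P} (\<preceq>) C \<and> P \<in> C \<and> Q \<in> C"

text \<open>Paths lying in \<open>Y\<close> are maximal chains of the ambient set \<open>X\<close>, not merely of \<open>Y\<close>.\<close>

definition num_paths :: "point set \<Rightarrow> point set \<Rightarrow> point \<Rightarrow> point \<Rightarrow> nat" where
  "num_paths X Y P Q = card {C. ladder_path X P Q C \<and> C \<subseteq> Y}"

definition upper_diag :: "nat \<Rightarrow> nat \<Rightarrow> nat \<Rightarrow> point set" where
  "upper_diag m n k =
     {(int m - int k + i, int n - i) | i. 0 \<le> i \<and> i \<le> int k} \<union>
     {(int m - int k + i, int n - 1 - i) | i. 0 \<le> i \<and> i \<le> int k - 1}"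

definition lower_diag :: "nat \<Rightarrow> point set" where
  "lower_diag l =
     {(i, int l + 2 - i) | i. 1 \<le> i \<and> i \<le> int l + 1} \<union>
     {(i + 1, int l + 2 - i) | i. 1 \<le> i \<and> i \<le> int l}"

text \<open>The region of the grid bounded by the two diagonal paths, boundary included: remove the points
  strictly beyond \<open>upper_diag\<close> (towards the corner \<open>(m, n)\<close>) and those strictly beyond
  \<open>lower_diag\<close> (towards the corner \<open>(1, 1)\<close>).\<close>

definition diag_ladder :: "nat \<Rightarrow> nat \<Rightarrow> nat \<Rightarrow> nat \<Rightarrow> point set" where
  "diag_ladder m n k l = grid m n
     - {(a, b). (a, b) \<notin> upper_diag m n k \<and> (\<exists>(c, d) \<in> upper_diag m n k. c \<le> a \<and> d \<le> b)}
     - {(a, b). (a, b) \<notin> lower_diag l \<and> (\<exists>(c, d) \<in> lower_diag l. a \<le> c \<and> b \<le> d)}"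

lemma mem_upper_diag:
  "(a, b) \<in> upper_diag m n k \<longleftrightarrow>
     int m - int k \<le> a \<and> a \<le> int m \<and> int n - int k \<le> b \<and> b \<le> int n \<and>
     (a + b = int m + int n - int k \<or> a + b = int m + int n - int k - 1)" (is "?L \<longleftrightarrow> ?R")
proof
  assume ?L
  then show ?R unfolding upper_diag_def by auto
next
  assume ?R
  then have "a = int m - int k + (int n - b) \<and> b = int n - (int n - b) \<and>
      0 \<le> int n - b \<and> int n - b \<le> int k \<or>
      a = int m - int k + (int n - 1 - b) \<and> b = int n - 1 - (int n - 1 - b) \<and>
      0 \<le> int n - 1 - b \<and> int n - 1 - b \<le> int k - 1" by linarith
  then show ?L unfolding upper_diag_def Un_iff mem_Collect_eq prod.inject by blast
qed

lemma mem_lower_diag: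
  "(a, b) \<in> lower_diag l \<longleftrightarrow>
     1 \<le> a \<and> a \<le> int l + 1 \<and> 1 \<le> b \<and> b \<le> int l + 1 \<and>
     (a + b = int l + 2 \<or> a + b = int l + 3)" (is "?L \<longleftrightarrow> ?R")
proof
  assume ?L
  then show ?R unfolding lower_diag_def by auto
next
  assume ?R
  then have "a = a \<and> b = int l + 2 - a \<and> 1 \<le> a \<and> a \<le> int l + 1 \<or>
      a = (a - 1) + 1 \<and> b = int l + 2 - (a - 1) \<and> 1 \<le> a - 1 \<and> a - 1 \<le> int l" by linarith
  then show ?L unfolding lower_diag_def Un_iff mem_Collect_eq prod.inject by blast
qed

lemma beyond_upper_diag:
  assumes "(a, b) \<in> grid m n"
  shows "(a, b) \<notin> upper_diag m n k \<and> (\<exists>(c, d) \<in> upper_diag m n k. c \<le> a \<and> d \<le> b)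
    \<longleftrightarrow> a + b > int m + int n - int k"
proof
  assume h: "(a, b) \<notin> upper_diag m n k \<and> (\<exists>(c, d) \<in> upper_diag m n k. c \<le> a \<and> d \<le> b)"
  then obtain c d where "(c, d) \<in> upper_diag m n k" "c \<le> a" "d \<le> b" by auto
  with h assms show "a + b > int m + int n - int k"
    unfolding mem_upper_diag grid_def by auto
next
  assume h: "a + b > int m + int n - int k"
  then have "(a, b) \<notin> upper_diag m n k" "(a, int m + int n - int k - a) \<in> upper_diag m n k"
    using assms unfolding mem_upper_diag grid_def by auto
  with h show "(a, b) \<notin> upper_diag m n k \<and> (\<exists>(c, d) \<in> upper_diag m n k. c \<le> a \<and> d \<le> b)"
    by (intro conjI bexI[of _ "(a, int m + int n - int k - a)"]) simp_all
qed

lemma beyond_lower_diag: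
  assumes "(a, b) \<in> grid m n"
  shows "(a, b) \<notin> lower_diag l \<and> (\<exists>(c, d) \<in> lower_diag l. a \<le> c \<and> b \<le> d)
    \<longleftrightarrow> a + b < int l + 2"
proof
  assume h: "(a, b) \<notin> lower_diag l \<and> (\<exists>(c, d) \<in> lower_diag l. a \<le> c \<and> b \<le> d)"
  then obtain c d where "(c, d) \<in> lower_diag l" "a \<le> c" "b \<le> d" by auto
  with h assms show "a + b < int l + 2"
    unfolding mem_lower_diag grid_def by auto
next
  assume h: "a + b < int l + 2"
  then have "(a, b) \<notin> lower_diag l" "(a, int l + 2 - a) \<in> lower_diag l"
    using assms unfolding mem_lower_diag grid_def by auto
  with h show "(a, b) \<notin> lower_diag l \<and> (\<exists>(c, d) \<in> lower_diag l. a \<le> c \<and> b \<le> d)"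
    by (intro conjI bexI[of _ "(a, int l + 2 - a)"]) simp_all
qed

lemma diag_ladder_eq:
  "diag_ladder m n k l =
     {(i, j) \<in> grid m n. int l + 2 \<le> i + j \<and> i + j \<le> int m + int n - int k}"
proof (rule set_eqI, clarify)
  fix a b
  show "(a, b) \<in> diag_ladder m n k l \<longleftrightarrow> (a, b) \<in>
     {(i, j). (i, j) \<in> grid m n \<and> int l + 2 \<le> i + j \<and> i + j \<le> int m + int n - int k}"
  proof (cases "(a, b) \<in> grid m n")
    case True
    have "(a, b) \<in> diag_ladder m n k l \<longleftrightarrow>
        \<not> ((a, b) \<notin> upper_diag m n k \<and> (\<exists>(c, d) \<in> upper_diag m n k. c \<le> a \<and> d \<le> b)) \<and>
        \<not> ((a, b) \<notin> lower_diag l \<and> (\<exists>(c, d) \<in> lower_diag l. a \<le> c \<and> b \<le> d))"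
      using True by (simp only: diag_ladder_def Diff_iff mem_Collect_eq prod.case simp_thms)
    then show ?thesis
      unfolding beyond_upper_diag[OF True] beyond_lower_diag[OF True] using True by auto
  next
    case False
    then show ?thesis by (simp add: diag_ladder_def)
  qed
qed

definition binom :: "int \<Rightarrow> int \<Rightarrow> real" where
  "binom N p = (if p < 0 \<or> p > N then 0 else real (nat N choose nat p))"

definition index_set :: "(int \<times> int) set" where
  "index_set = {(i, j). i - j = 0 \<or> i - j = 1}"

lemma finite_support:
  fixes m n k l :: nat
  assumes "int k \<le> min (int m - 2) (int n - 2)" and "int l \<le> min (int m - 2) (int n - 2)"
  shows "finite {(i, j) \<in> index_set. binom (int m + int n - 2)
           (int m - 1 + i * (int k - int m) + j * (int l - int n)) \<noteq> 0}"
proof (rule finite_subset)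
  let ?B = "int m + int n"
  let ?D = "int m + int n - int k - int l"
  have D: "?D \<ge> 1" using assms by linarith
  show "{(i, j) \<in> index_set. binom (int m + int n - 2)
           (int m - 1 + i * (int k - int m) + j * (int l - int n)) \<noteq> 0}
        \<subseteq> {- ?B - 1..?B + 1} \<times> {- ?B - 1..?B + 1}"
  proof (clarify)
    fix i j
    let ?p = "int m - 1 + i * (int k - int m) + j * (int l - int n)"
    assume ij: "(i, j) \<in> index_set" and nz: "binom (int m + int n - 2) ?p \<noteq> 0"
    have p: "0 \<le> ?p" "?p \<le> int m + int n - 2"
      using nz by (auto simp: binom_def split: if_splits)
    have e: "i = j \<or> i = j + 1" using ij by (auto simp: index_set_def)
    have "?p = int m - 1 + (i - j) * (int k - int m) - j * ?D" by (simp add: algebra_simps)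
    with p e assms have "\<bar>j * ?D\<bar> \<le> ?B" by auto
    moreover have "\<bar>j\<bar> \<le> \<bar>j * ?D\<bar>"
      using D mult_left_mono[of 1 ?D "\<bar>j\<bar>"] by (simp add: abs_mult)
    ultimately show "i \<in> {- ?B - 1..?B + 1} \<and> j \<in> {- ?B - 1..?B + 1}"
      using e by auto
  qed
qed auto

end

theory Submission
  imports Defs
begin

text \<open>The sum \<open>a + b\<close> performs a simple walk along a path, so the paths in the ladder are walks
  confined between the absorbing levels \<open>l + 1\<close> and \<open>m + n - k + 1\<close>. Their number obeys the Pascal
  recursion inside the strip and vanishes on both levels; so does the alternating sum over the images
  of the target point under the two reflections, because binomial sums over a residue class are
  periodic and symmetric. The two agree on walks of length \<open>0\<close>, hence everywhere.\<close>

section \<open>Binomial sums over a residue class\<close>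

text \<open>The sum of \<open>N choose q\<close> over all \<open>q\<close> congruent to \<open>p\<close> modulo \<open>D\<close> (see
  \<open>has_sum_periodic_binom\<close>), defined by Pascal's rule so that periodicity and symmetry are immediate.\<close>

fun periodic_binom :: "int \<Rightarrow> nat \<Rightarrow> int \<Rightarrow> real" where
  "periodic_binom D 0 p = (if D dvd p then 1 else 0)"
| "periodic_binom D (Suc N) p = periodic_binom D N p + periodic_binom D N (p - 1)"

lemma periodic_binom_diff_period: "periodic_binom D N (p - D) = periodic_binom D N p"
proof (induction N arbitrary: p)
  case 0
  show ?case by (simp add: dvd_diff_left_iff)
next
  case (Suc N)
  have "p - D - 1 = p - 1 - D" by simp
  then show ?case using Suc[of p] Suc[of "p - 1"] by (simp only: periodic_binom.simps add.commute)
qed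

text \<open>The induction works because \<open>p\<close> to \<open>N - p\<close> swaps the two
  Pascal terms. Together with periodicity this gives equal values at two arguments whose sum is
  \<open>N\<close> modulo \<open>D\<close>, which is what happens on both barriers.\<close>

lemma periodic_binom_symmetric: "periodic_binom D N (int N - p) = periodic_binom D N p"
proof (induction N arbitrary: p)
  case 0
  show ?case by simp
next
  case (Suc N)
  have "int (Suc N) - p = int N - (p - 1)" "int (Suc N) - p - 1 = int N - p" by simp_all
  then show ?case using Suc[of p] Suc[of "p - 1"] by (simp only: periodic_binom.simps add.commute)
qed

lemma binom_of_nat: "binom (int N) (int q) = real (N choose q)"
  by (auto simp: binom_def binomial_eq_0)

text \<open>The zero convention extends Pascal's rule to every integer \<open>p\<close>, so sums
  over all of \<open>int\<close> need no boundary terms.\<close>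

lemma binom_Suc: "binom (int (Suc N)) p = binom (int N) p + binom (int N) (p - 1)"
proof (cases "p < 1")
  case True
  then show ?thesis by (cases "p = 0") (auto simp: binom_def)
next
  case False
  then obtain q where "p = 1 + int q"
    using zle_iff_zadd[of 1 p] by auto
  then have "p = int (Suc q)" "p - 1 = int q" by simp_all
  then show ?thesis by (simp only: binom_of_nat binomial_Suc_Suc of_nat_add add.commute)
qed

lemma has_sum_periodic_binom:
  assumes "D > 0"
  shows "((\<lambda>r. binom (int N) (p - r * D)) has_sum periodic_binom D N p) (UNIV :: int set)"
proof (induction N arbitrary: p)
  case 0
  have b: "binom 0 q = (if q = 0 then 1 else 0)" for q by (auto simp: binom_def)
  have z: "p - r * D = 0 \<longleftrightarrow> D dvd p \<and> r = p div D" for r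
    using assms by auto
  have "((\<lambda>r. binom (int 0) (p - r * D)) has_sum (\<Sum>r\<in>{p div D}. binom (int 0) (p - r * D)))
          {p div D}"
    by (rule has_sum_finite) simp
  also have "(\<Sum>r\<in>{p div D}. binom (int 0) (p - r * D)) = periodic_binom D 0 p"
    using z by (simp add: b)
  finally show ?case
    \<comment> \<open>At \<open>N = 0\<close> only \<open>r = p div D\<close> can contribute, so the
      sum over this singleton extends to all integers.\<close>
    by (rule has_sum_cong_neutral[THEN iffD1, rotated -1]) (use z in \<open>auto simp: b\<close>)
next
  case (Suc N)
  show ?case
    using has_sum_add[OF Suc[of p] Suc[of "p - 1"]]
    unfolding binom_Suc periodic_binom.simps(2)
    by (simp add: algebra_simps)
qed

text \<open>\<open>index_set\<close> is the disjoint union of two diagonals, each parametrised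
  injectively by \<open>j\<close>.\<close>

lemma has_sum_index_set:
  fixes f :: "int \<times> int \<Rightarrow> real"
  assumes "((\<lambda>j. f (j, j)) has_sum A) UNIV" "((\<lambda>j. f (j + 1, j)) has_sum B) UNIV"
  shows "(f has_sum (A + B)) index_set"
proof -
  have e: "index_set = range (\<lambda>j. (j, j)) \<union> range (\<lambda>j. (j + 1, j))"
    unfolding index_set_def by (auto simp: image_iff algebra_simps)
  have "(f has_sum A) (range (\<lambda>j. (j, j)))" "(f has_sum B) (range (\<lambda>j. (j + 1, j)))"
    using assms by (auto simp: has_sum_reindex inj_on_def o_def)
  then show ?thesis
    unfolding e by (rule has_sum_Un_disjoint) auto
qed

section \<open>First-step decomposition of ladder paths\<close>

text \<open>The library's chains use the reflexive closure, which changes nothing for the reflexive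
  order \<preceq>.\<close>

lemma chain_pt_le:
  "pred_on.chain A (\<preceq>) S \<longleftrightarrow> S \<subseteq> A \<and> (\<forall>x\<in>S. \<forall>y\<in>S. x \<preceq> y \<or> y \<preceq> x)"
proof -
  have "(\<preceq>)\<^sup>=\<^sup>= = (\<preceq>)" by (auto simp: fun_eq_iff pt_le_def)
  then show ?thesis unfolding pred_on.chain_def by simp
qed

lemma ladder_path_D:
  assumes "ladder_path X P Q C"
  shows "C \<subseteq> {R \<in> X. Q \<preceq> R \<and> R \<preceq> P}" "\<forall>x\<in>C. \<forall>y\<in>C. x \<preceq> y \<or> y \<preceq> x" "P \<in> C" "Q \<in> C"
  using assms unfolding ladder_path_def pred_on.maxchain_def chain_pt_le by simp_all

lemma ladder_path_maximal:
  assumes "ladder_path X P Q C" "C \<subseteq> S" "S \<subseteq> {R \<in> X. Q \<preceq> R \<and> R \<preceq> P}"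
    "\<forall>x\<in>S. \<forall>y\<in>S. x \<preceq> y \<or> y \<preceq> x"
  shows "S = C"
proof (rule ccontr)
  let ?A = "{R \<in> X. Q \<preceq> R \<and> R \<preceq> P}"
  assume "S \<noteq> C"
  then have "C \<subset> S" using assms(2) by blast
  moreover have "pred_on.chain ?A (\<preceq>) S" unfolding chain_pt_le using assms(3,4) by simp
  ultimately show False
    using assms(1) unfolding ladder_path_def pred_on.maxchain_def by metis
qed

lemma ladder_path_I:
  assumes "C \<subseteq> {R \<in> X. Q \<preceq> R \<and> R \<preceq> P}" "\<forall>x\<in>C. \<forall>y\<in>C. x \<preceq> y \<or> y \<preceq> x" "P \<in> C" "Q \<in> C"
    and max: "\<And>S. C \<subseteq> S \<Longrightarrow> S \<subseteq> {R \<in> X. Q \<preceq> R \<and> R \<preceq> P} \<Longrightarrow>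
      \<forall>x\<in>S. \<forall>y\<in>S. x \<preceq> y \<or> y \<preceq> x \<Longrightarrow> S = C"
  shows "ladder_path X P Q C"
proof -
  let ?A = "{R \<in> X. Q \<preceq> R \<and> R \<preceq> P}"
  have "pred_on.chain ?A (\<preceq>) C" unfolding chain_pt_le using assms(1,2) by simp
  moreover have "\<not> C \<subset> S" if "pred_on.chain ?A (\<preceq>) S" for S
    using max[of S] that unfolding chain_pt_le by (metis psubset_eq)
  ultimately show ?thesis
    unfolding ladder_path_def pred_on.maxchain_def using assms(3,4) by metis
qed

lemma ladder_path_endpoint_in: "ladder_path X P Q C \<Longrightarrow> P \<in> X"
  using ladder_path_D(1,3) by blast

lemma ladder_path_le: "ladder_path X P Q C \<Longrightarrow> R \<in> C \<Longrightarrow> R \<preceq> P"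
  using ladder_path_D(1) by blast

lemma ladder_path_refl: "ladder_path X Q Q C \<longleftrightarrow> Q \<in> X \<and> C = {Q}"
proof
  have Q: "{R \<in> X. Q \<preceq> R \<and> R \<preceq> Q} \<subseteq> {Q}" "Q \<preceq> Q"
    by (auto simp: pt_le_def prod_eq_iff)
  {
    assume "ladder_path X Q Q C"
    then show "Q \<in> X \<and> C = {Q}" using ladder_path_D(1,3) Q by blast
  next
    assume "Q \<in> X \<and> C = {Q}"
    then show "ladder_path X Q Q C" using Q by (intro ladder_path_I) blast+
  }
qed

text \<open>The hypothesis \<open>cov\<close> says that \<open>P\<close> covers \<open>P'\<close> in a form that needs no case distinction on
  the direction of the step.\<close>

lemma ladder_path_insert:
  assumes C: "ladder_path X P' Q C" and P: "P \<in> X" "P' \<preceq> P" "Q \<preceq> P"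
    and cov: "\<And>R. R \<preceq> P \<Longrightarrow> R \<noteq> P \<Longrightarrow> R \<preceq> P' \<or> P' \<preceq> R \<Longrightarrow> R \<preceq> P'"
    and nle: "\<not> P \<preceq> P'"
  shows "ladder_path X P Q (insert P C)"
proof (rule ladder_path_I)
  note C' = ladder_path_D[OF C]
  have tr: "R \<preceq> P" if "R \<preceq> P'" for R using that P by (auto simp: pt_le_def)
  have rP: "P \<preceq> P" by (simp add: pt_le_def)
  show "insert P C \<subseteq> {R \<in> X. Q \<preceq> R \<and> R \<preceq> P}" using C'(1) P tr rP by blast
  show "\<forall>x\<in>insert P C. \<forall>y\<in>insert P C. x \<preceq> y \<or> y \<preceq> x" using C'(1,2) tr rP by blast
  show "P \<in> insert P C" "Q \<in> insert P C" using C'(4) by simp_all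
  fix S
  assume S: "insert P C \<subseteq> S" "S \<subseteq> {R \<in> X. Q \<preceq> R \<and> R \<preceq> P}" "\<forall>x\<in>S. \<forall>y\<in>S. x \<preceq> y \<or> y \<preceq> x"
  \<comment> \<open>Any chain \<open>S\<close> extending \<open>insert P C\<close> lies below
    \<open>P'\<close> once \<open>P\<close> is deleted, so the maximality of \<open>C\<close>
    applies to \<open>S - {P}\<close>.\<close>
  have "R \<preceq> P'" if R: "R \<in> S - {P}" for R
  proof (rule cov)
    show "R \<preceq> P" "R \<noteq> P" using R S(2) by auto
    have "P' \<in> S" using S(1) C'(3) by blast
    then show "R \<preceq> P' \<or> P' \<preceq> R" using R S(3) by blast
  qed
  then have "S - {P} \<subseteq> {R \<in> X. Q \<preceq> R \<and> R \<preceq> P'}" using S(2) by blast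
  moreover have "C \<subseteq> S - {P}" using S(1) C'(1) nle by blast
  moreover have "\<forall>x\<in>S - {P}. \<forall>y\<in>S - {P}. x \<preceq> y \<or> y \<preceq> x" using S(3) by simp
  ultimately have "S - {P} = C" using ladder_path_maximal[OF C] by simp
  then show "S = insert P C" using S(1) by blast
qed

text \<open>Converse of insertion: a chain extending \<open>C - {P}\<close> below \<open>P'\<close>
  becomes an extension of \<open>C\<close> when \<open>P\<close> is put back, so maximality is
  inherited.\<close>

lemma ladder_path_remove:
  assumes C: "ladder_path X P Q C" and P': "P' \<in> X" "P' \<preceq> P" "Q \<preceq> P'" and "Q \<noteq> P"
    and sub: "\<And>R. R \<in> C \<Longrightarrow> R \<noteq> P \<Longrightarrow> R \<preceq> P'" and nle: "\<not> P \<preceq> P'"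
  shows "ladder_path X P' Q (C - {P})"
proof (rule ladder_path_I)
  note C' = ladder_path_D[OF C]
  have tr: "R \<preceq> P" if "R \<preceq> P'" for R using that P' by (auto simp: pt_le_def)
  have rP: "P' \<preceq> P'" "P \<preceq> P" by (auto simp: pt_le_def)
  show 1: "C - {P} \<subseteq> {R \<in> X. Q \<preceq> R \<and> R \<preceq> P'}" using C'(1) sub by blast
  show 2: "\<forall>x\<in>C - {P}. \<forall>y\<in>C - {P}. x \<preceq> y \<or> y \<preceq> x" using C'(2) by simp
  show "Q \<in> C - {P}" using C'(4) \<open>Q \<noteq> P\<close> by simp
  show max: "S = C - {P}" if S: "C - {P} \<subseteq> S" "S \<subseteq> {R \<in> X. Q \<preceq> R \<and> R \<preceq> P'}"
    "\<forall>x\<in>S. \<forall>y\<in>S. x \<preceq> y \<or> y \<preceq> x" for S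
  proof -
    have P: "P \<in> {R \<in> X. Q \<preceq> R \<and> R \<preceq> P}" using C'(1,3) by blast
    then have "insert P S \<subseteq> {R \<in> X. Q \<preceq> R \<and> R \<preceq> P}" using S(2) tr by blast
    moreover have "\<forall>x\<in>insert P S. \<forall>y\<in>insert P S. x \<preceq> y \<or> y \<preceq> x"
      using S(2,3) tr rP by blast
    moreover have "C \<subseteq> insert P S" using S(1) by blast
    ultimately have "insert P S = C" using ladder_path_maximal[OF C] by simp
    moreover have "P \<notin> S" using S(2) nle by blast
    ultimately show ?thesis by blast
  qed
  \<comment> \<open>That \<open>P'\<close> lies on the path is not assumed: it is comparable to
    everything left, so maximality forces it in.\<close>
  have "insert P' (C - {P}) = C - {P}"
  proof (rule max)
    show "insert P' (C - {P}) \<subseteq> {R \<in> X. Q \<preceq> R \<and> R \<preceq> P'}" using 1 P' rP by blast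
    show "\<forall>x\<in>insert P' (C - {P}). \<forall>y\<in>insert P' (C - {P}). x \<preceq> y \<or> y \<preceq> x"
      using 1 2 rP by blast
  qed blast
  then show "P' \<in> C - {P}" by blast
qed

text \<open>Outside the grid there are no paths, so the right-hand side is also correct on its border.\<close>

lemma ladder_path_step:
  assumes "(a, b) \<in> grid m n" "(a, b) \<noteq> (int m, 1)"
  shows "ladder_path (grid m n) (a, b) (int m, 1) C \<longleftrightarrow>
    (\<exists>C'. C = insert (a, b) C' \<and> (ladder_path (grid m n) (a + 1, b) (int m, 1) C' \<or>
                                 ladder_path (grid m n) (a, b - 1) (int m, 1) C'))"
    (is "?L \<longleftrightarrow> ?R")
proof
  let ?X = "grid m n" and ?Q = "(int m, 1 :: int)"
  assume L: ?L
  note L' = ladder_path_D[OF L]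
  have ins: "C = insert (a, b) (C - {(a, b)})" using L' by blast
  have Q: "?Q \<in> C" "?Q \<noteq> (a, b)" using L' assms by auto
  show ?R
  \<comment> \<open>A second point \<open>(i, b)\<close> of \<open>C\<close> has
    \<open>i > a\<close> and is incomparable to every \<open>(a, s)\<close> with
    \<open>s < b\<close>, so the path starts to the right. Otherwise all other points have second
    coordinate below \<open>b\<close>, and it starts downwards.\<close>
  proof (cases "\<exists>i. i \<noteq> a \<and> (i, b) \<in> C")
    case True
    then obtain i where i: "i \<noteq> a" "(i, b) \<in> C" by blast
    have "(i, b) \<preceq> (a, b)" "(i, b) \<in> ?X" using i L' by blast+
    then have ai: "a < i" "i \<le> int m" using i by (auto simp: pt_le_def grid_def)
    have "R \<preceq> (a + 1, b)" if R: "R \<in> C" "R \<noteq> (a, b)" for R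
    proof -
      have "R \<preceq> (a, b)" "R \<preceq> (i, b) \<or> (i, b) \<preceq> R" using L' R i by blast+
      then show ?thesis using R ai by (cases R) (auto simp: pt_le_def)
    qed
    moreover have "(a + 1, b) \<in> ?X" using ai assms by (auto simp: grid_def)
    ultimately have "ladder_path ?X (a + 1, b) ?Q (C - {(a, b)})"
      using Q ai assms by (intro ladder_path_remove[OF L]) (auto simp: pt_le_def grid_def)
    then show ?thesis using ins by blast
  next
    case False
    have *: "R \<preceq> (a, b - 1)" if R: "R \<in> C" "R \<noteq> (a, b)" for R
    proof -
      have "R \<preceq> (a, b)" using L' R by blast
      then show ?thesis using R False by (cases R) (force simp: pt_le_def)
    qed
    from *[of ?Q] Q have "b > 1" by (auto simp: pt_le_def)
    then have "ladder_path ?X (a, b - 1) ?Q (C - {(a, b)})"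
      using Q * assms by (intro ladder_path_remove[OF L]) (auto simp: pt_le_def grid_def)
    then show ?thesis using ins by blast
  qed
next
  assume ?R
  then obtain C' where C: "C = insert (a, b) C'"
    "ladder_path (grid m n) (a + 1, b) (int m, 1) C' \<or> ladder_path (grid m n) (a, b - 1) (int m, 1) C'"
    by blast
  from C(2) show ?L
  proof
    assume "ladder_path (grid m n) (a + 1, b) (int m, 1) C'"
    then show ?L unfolding C
      by (rule ladder_path_insert) (use assms in \<open>auto simp: pt_le_def grid_def prod_eq_iff\<close>)
  next
    assume "ladder_path (grid m n) (a, b - 1) (int m, 1) C'"
    then show ?L unfolding C
      by (rule ladder_path_insert) (use assms in \<open>auto simp: pt_le_def grid_def prod_eq_iff\<close>)
  qed
qed

section \<open>Counting paths by their first step\<close>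

lemma num_paths_eq_0: "P \<notin> X \<or> P \<notin> Y \<Longrightarrow> num_paths X Y P Q = 0"
proof -
  assume "P \<notin> X \<or> P \<notin> Y"
  then have "{C. ladder_path X P Q C \<and> C \<subseteq> Y} = {}"
    using ladder_path_endpoint_in[of X P Q] by (auto simp: ladder_path_def)
  then show ?thesis by (simp only: num_paths_def card.empty)
qed

lemma num_paths_refl: "Q \<in> X \<Longrightarrow> Q \<in> Y \<Longrightarrow> num_paths X Y Q Q = 1"
proof -
  assume "Q \<in> X" "Q \<in> Y"
  then have "{C. ladder_path X Q Q C \<and> C \<subseteq> Y} = {{Q}}"
    by (auto simp: ladder_path_refl)
  then show ?thesis by (simp add: num_paths_def)
qed

lemma num_paths_step:
  assumes "(a, b) \<in> grid m n" "(a, b) \<in> Y" "(a, b) \<noteq> (int m, 1)"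
  shows "num_paths (grid m n) Y (a, b) (int m, 1) =
    num_paths (grid m n) Y (a + 1, b) (int m, 1) + num_paths (grid m n) Y (a, b - 1) (int m, 1)"
proof -
  define L where "L P = {C. ladder_path (grid m n) P (int m, 1) C \<and> C \<subseteq> Y}" for P
  have "grid m n \<subseteq> {1..int m} \<times> {1..int n}" by (auto simp: grid_def)
  then have "finite (grid m n)" by (rule finite_subset) simp
  moreover have "L P \<subseteq> Pow (grid m n)" for P
    unfolding L_def using ladder_path_D(1) by blast
  ultimately have fin: "finite (L P)" for P by (meson finite_Pow_iff finite_subset)
  have "L (a, b) = insert (a, b) ` (L (a + 1, b) \<union> L (a, b - 1))"
    unfolding L_def ladder_path_step[OF assms(1,3)] using assms(2) by blast
  \<comment> \<open>A path lies below its starting point, and \<open>(a, b)\<close> lies below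
    neither successor; hence inserting \<open>(a, b)\<close> loses no information.\<close>
  moreover have notin: "(a, b) \<notin> C" if "C \<in> L (a + 1, b) \<union> L (a, b - 1)" for C
    using that ladder_path_le[of _ _ _ C "(a, b)"] by (force simp: L_def pt_le_def)
  then have "inj_on (insert (a, b)) (L (a + 1, b) \<union> L (a, b - 1))"
    unfolding inj_on_def by (metis Diff_insert_absorb insert_absorb)
  moreover have "L (a + 1, b) \<inter> L (a, b - 1) = {}"
  proof (rule ccontr)
    assume "L (a + 1, b) \<inter> L (a, b - 1) \<noteq> {}"
    then obtain C where C: "ladder_path (grid m n) (a + 1, b) (int m, 1) C"
      "ladder_path (grid m n) (a, b - 1) (int m, 1) C" by (auto simp: L_def)
    then have "(a + 1, b) \<preceq> (a, b - 1)"
      using ladder_path_le by (metis ladder_path_def)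
    then show False by (simp add: pt_le_def)
  qed
  ultimately have "card (L (a, b)) = card (L (a + 1, b)) + card (L (a, b - 1))"
    using fin by (simp add: card_image card_Un_disjoint)
  then show ?thesis by (simp add: num_paths_def L_def)
qed

section \<open>Reflection\<close>

text \<open>\<open>N\<close> is the number of steps left, \<open>m - a\<close> of them to the right.
  Reflecting the target in the level \<open>m + n - k + 1\<close> turns \<open>m - a\<close> into
  \<open>m + n - k - a\<close>. The barriers are \<open>D\<close> apart, so composing both
  reflections shifts \<open>a + b\<close> by \<open>2 * D\<close> and the number of right steps by
  \<open>D\<close>. The bounds on \<open>a + b\<close> include both barriers, so a step from inside
  stays in range.\<close>

lemma num_paths_reflection:
  fixes m n k l N :: nat and a b :: int
  assumes k: "int k \<le> min (int m - 2) (int n - 2)" and l: "int l \<le> min (int m - 2) (int n - 2)"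
    and "int N = int m - a + b - 1" and "1 \<le> a" and "b \<le> int n"
    and "int l + 1 \<le> a + b" and "a + b \<le> int m + int n - int k + 1"
  defines "D \<equiv> int m + int n - int k - int l"
  shows "real (num_paths (grid m n) (diag_ladder m n k l) (a, b) (int m, 1)) =
    periodic_binom D N (int m - a) - periodic_binom D N (int m + int n - int k - a)"
  using assms(3-7)
proof (induction N arbitrary: a b)
  let ?X = "grid m n" and ?Y = "diag_ladder m n k l" and ?Q = "(int m, 1 :: int)"
  have barrier: "real (num_paths ?X ?Y (a, b) ?Q) =
      periodic_binom D N (int m - a) - periodic_binom D N (int m + int n - int k - a)"
    if N: "int N = int m - a + b - 1"
      and s: "a + b = int l + 1 \<or> a + b = int m + int n - int k + 1" for a b N
  proof -
    have "(a, b) \<notin> ?Y" using s by (auto simp: diag_ladder_eq)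
    then have "num_paths ?X ?Y (a, b) ?Q = 0" by (simp add: num_paths_eq_0)
    \<comment> \<open>The two arguments add up to \<open>N\<close> on the upper barrier and to
      \<open>N + D\<close> on the lower one.\<close>
    moreover have "periodic_binom D N (int m - a) = periodic_binom D N (int m + int n - int k - a)"
      using s
    proof
      assume "a + b = int l + 1"
      then have "int N - (int m - a) = int m + int n - int k - a - D" using N by (simp add: D_def)
      then show ?thesis
        using periodic_binom_symmetric[of D N "int m - a"] periodic_binom_diff_period by metis
    next
      assume "a + b = int m + int n - int k + 1"
      then have "int N - (int m - a) = int m + int n - int k - a" using N by simp
      then show ?thesis using periodic_binom_symmetric[of D N "int m - a"] by metis
    qed
    ultimately show ?thesis by simp
  qed
  {
    case 0
    show ?case
    proof (cases "a + b = int l + 1 \<or> a + b = int m + int n - int k + 1")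
      case True
      then show ?thesis using barrier 0 by blast
    next
      case False
      \<comment> \<open>Strictly between the barriers \<open>N = 0\<close> gives
        \<open>0 < m + n - k - a < D\<close>, by the bounds on \<open>k\<close> and
        \<open>l\<close>.\<close>
      have nd: "\<not> D dvd int m + int n - int k - a"
        using 0 False k l by (intro zdvd_not_zless) (auto simp: D_def)
      show ?thesis
      proof (cases "a = int m")
        case True
        then have "b = 1" using 0 by simp
        moreover have "?Q \<in> ?X" "?Q \<in> ?Y" using k l by (auto simp: diag_ladder_eq grid_def)
        ultimately show ?thesis using nd True by (simp add: num_paths_refl)
      next
        case ne: False
        \<comment> \<open>Here \<open>b - 1 = a - m\<close> is nonzero, so either
          \<open>a > m\<close> or \<open>b < 1\<close>.\<close>
        then have "(a, b) \<notin> ?X" using 0 by (auto simp: grid_def)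
        moreover have "\<not> D dvd \<bar>int m - a\<bar>"
          using 0 False k l ne by (intro zdvd_not_zless) (auto simp: D_def)
        ultimately show ?thesis using nd by (simp add: num_paths_eq_0)
      qed
    qed
  next
    case (Suc N)
    show ?case
    proof (cases "a + b = int l + 1 \<or> a + b = int m + int n - int k + 1")
      case True
      then show ?thesis using barrier Suc.prems by blast
    next
      case False
      have "num_paths ?X ?Y (a, b) ?Q =
          num_paths ?X ?Y (a + 1, b) ?Q + num_paths ?X ?Y (a, b - 1) ?Q"
      proof (cases "(a, b) \<in> ?X")
        case True
        moreover have "(a, b) \<in> ?Y" using True False Suc.prems by (auto simp: diag_ladder_eq)
        moreover have "(a, b) \<noteq> ?Q" using Suc.prems by auto
        ultimately show ?thesis by (rule num_paths_step)
      next
        case out: False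
        \<comment> \<open>As \<open>1 \<le> a\<close> and \<open>b \<le> n\<close>, the point has
          \<open>a > m\<close> or \<open>b < 1\<close>, and neither step leads back into the grid:
          the recursion reads \<open>0 = 0 + 0\<close>.\<close>
        then have "(a + 1, b) \<notin> ?X" "(a, b - 1) \<notin> ?X" using Suc.prems by (auto simp: grid_def)
        with out show ?thesis by (simp add: num_paths_eq_0)
      qed
      moreover have "real (num_paths ?X ?Y (a + 1, b) ?Q) = periodic_binom D N (int m - (a + 1))
          - periodic_binom D N (int m + int n - int k - (a + 1))"
        using Suc.prems False by (intro Suc.IH) auto
      moreover have "real (num_paths ?X ?Y (a, b - 1) ?Q) = periodic_binom D N (int m - a)
          - periodic_binom D N (int m + int n - int k - a)"
        using Suc.prems False by (intro Suc.IH) auto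
      moreover have "p - (a + 1) = p - a - 1" for p by simp
      ultimately show ?thesis by simp
    qed
  }
qed

section \<open>Evaluation of the signed sum over \<open>index_set\<close>\<close>

theorem theorem3p1:
  fixes m n k l :: nat
  assumes "int k \<le> min (int m - 2) (int n - 2)"
    and "int l \<le> min (int m - 2) (int n - 2)"
  shows "real (num_paths (grid m n) (diag_ladder m n k l) (1, int n) (int m, 1)) =
    (\<Sum>\<^sub>\<infinity>(i, j)\<in>index_set. (- 1) powi (i + j) *
       binom (int m + int n - 2) (int m - 1 + i * (int k - int m) + j * (int l - int n)))"
proof -
  define D where "D = int m + int n - int k - int l"
  define N where "N = m + n - 2"
  have N: "int N = int m + int n - 2" using assms unfolding N_def by simp
  have "D > 0" using assms unfolding D_def by simp
  note sums = has_sum_periodic_binom[OF this, of N]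
  let ?f = "\<lambda>(i, j). (- 1) powi (i + j) *
       binom (int m + int n - 2) (int m - 1 + i * (int k - int m) + j * (int l - int n))"
  have "?f (j, j) = binom (int N) (int m - 1 - j * D)" for j
    by (simp add: N D_def algebra_simps)
  then have 0: "((\<lambda>j. ?f (j, j)) has_sum periodic_binom D N (int m - 1)) UNIV"
    using sums[of "int m - 1"] by simp
  \<comment> \<open>The extra summand \<open>k - m\<close> from \<open>i = j + 1\<close> turns
    \<open>m - 1\<close> into \<open>k - 1\<close>, and \<open>i + j\<close> becomes odd.\<close>
  have "?f (j + 1, j) = - binom (int N) (int k - 1 - j * D)" for j
  proof -
    have "j + 1 + j = 2 * j + 1" by simp
    then have "(- 1 :: real) powi (j + 1 + j) = - 1" by (simp add: power_int_minus_one_minus)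
    then show ?thesis by (simp add: N D_def algebra_simps)
  qed
  then have 1: "((\<lambda>j. ?f (j + 1, j)) has_sum - periodic_binom D N (int k - 1)) UNIV"
    using sums[of "int k - 1"] by (simp add: has_sum_uminus)
  \<comment> \<open>The diagonal sum ends at \<open>k - 1\<close>, the reflection formula at
    \<open>m + n - k - 1\<close>; these are complementary with respect to \<open>N\<close>.\<close>
  have "int N - (int k - 1) = int m + int n - int k - 1" using N by simp
  then have sym: "periodic_binom D N (int k - 1) = periodic_binom D N (int m + int n - int k - 1)"
    using periodic_binom_symmetric[of D N "int k - 1"] by metis
  have "real (num_paths (grid m n) (diag_ladder m n k l) (1, int n) (int m, 1)) =
      periodic_binom D N (int m - 1) - periodic_binom D N (int m + int n - int k - 1)"
    unfolding D_def using assms N by (intro num_paths_reflection) auto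
  then show ?thesis using infsumI[OF has_sum_index_set[OF 0 1]] sym by simp
qed

end
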